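(* Let $A\in\mathbb{R}^{n_x\times n_x}$, $B\in\mathbb{R}^{n_x\times n_u}$, $C\in\mathbb{R}^{n_y\times n_x}$, $A_c\in\mathbb{R}^{n_c\times n_c}$, $B_c\in\mathbb{R}^{n_c\times n_y}$, $C_c\in\mathbb{R}^{n_u\times n_c}$, $D_c\in\mathbb{R}^{n_u\times n_y}$, let $T\ge 1$ be an integer, and set $$F=\begin{bmatrix}A+BD_cC & BC_c\\ B_cC & A_c\end{bmatrix},\qquad H=\begin{bmatrix}I_{n_x}&0\\0&0\end{bmatrix}\in\mathbb{R}^{(n_x+n_c)\times(n_x+n_c)}.$$ Suppose there exist a symmetric matrix $P\in\mathbb{R}^{(n_x+n_c)\times(n_x+n_c)}$ and scalars $\varepsilon\in(0,1)$, $\mu\in[-1,0)$, $\delta\in[1,\infty)$, $\epsilon\in(0,\infty)$ such that $$P\succ\epsilon I,\qquad F^\top PF\preceq(1+\mu)P,\qquad F^\top HPHF\preceq\delta P,\qquad \delta(1+\mu)^{T-1}<\varepsilon .$$ Then the closed loop of the plant with the resetting controller (defined in the context) is globally asymptotically stable (with respect to the origin).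
   Context: Plant: $x[k+1]=Ax[k]+Bu[k]$, $y[k]=Cx[k]$, $x[0]=x_0$, with $x[k]\in\mathbb{R}^{n_x}$, $u[k]\in\mathbb{R}^{n_u}$, $y[k]\in\mathbb{R}^{n_y}$, $k=0,1,2,\dots$. Resetting controller with state $x_c[k]\in\mathbb{R}^{n_c}$: $x_c[k+1]=A_cx_c[k]+B_cy[k]$ if $(k+1)\bmod T\neq0$, $x_c[k+1]=0$ if $(k+1)\bmod T=0$, and $u[k]=C_cx_c[k]+D_cy[k]$. The controller state is zero at every multiple of $T$: $x_c[\ell T]=0$ for all $\ell=0,1,2,\dots$. With $z[k]=(x[k]^\top,x_c[k]^\top)^\top$ the closed loop is $z[k+1]=Fz[k]$ if $(k+1)\bmod T\ne0$ and $z[k+1]=HFz[k]$ if $(k+1)\bmod T=0$. For symmetric matrices, $\succ,\succeq,\prec,\preceq$ denote the Loewner order. The convention $0^0=1$ is used. *)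

theory Defs
  imports "HOL-Analysis.Analysis"
begin

definition pos_definite :: "real ^ 'n ^ 'n \<Rightarrow> bool" where
  "pos_definite M \<longleftrightarrow> transpose M = M \<and> (\<forall>v. v \<noteq> 0 \<longrightarrow> 0 < v \<bullet> (M *v v))"

definition pos_semidefinite :: "real ^ 'n ^ 'n \<Rightarrow> bool" where
  "pos_semidefinite M \<longleftrightarrow> transpose M = M \<and> (\<forall>v. 0 \<le> v \<bullet> (M *v v))"

definition loewner_le :: "real ^ 'n ^ 'n \<Rightarrow> real ^ 'n ^ 'n \<Rightarrow> bool"  (infix "\<preceq>\<^sub>L" 50) where
  "M \<preceq>\<^sub>L N \<longleftrightarrow> pos_semidefinite (N - M)"

definition loewner_less :: "real ^ 'n ^ 'n \<Rightarrow> real ^ 'n ^ 'n \<Rightarrow> bool"  (infix "\<prec>\<^sub>L" 50) where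
  "M \<prec>\<^sub>L N \<longleftrightarrow> pos_definite (N - M)"

definition stack :: "real ^ 'n \<Rightarrow> real ^ 'm \<Rightarrow> real ^ ('n + 'm)" where
  "stack v w = (\<chi> i. case i of Inl a \<Rightarrow> v $ a | Inr b \<Rightarrow> w $ b)"

text \<open>\<^term>\<open>block_matrix M11 M12 M21 M22\<close> lists the blocks row by row.\<close>

definition block_matrix ::
  "real ^ 'n ^ 'p \<Rightarrow> real ^ 'm ^ 'p \<Rightarrow> real ^ 'n ^ 'q \<Rightarrow> real ^ 'm ^ 'q \<Rightarrow> real ^ ('n + 'm) ^ ('p + 'q)" where
  "block_matrix M11 M12 M21 M22 =
    (\<chi> i. case i of Inl a \<Rightarrow> stack (M11 $ a) (M12 $ a) | Inr b \<Rightarrow> stack (M21 $ b) (M22 $ b))"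

definition flow_matrix ::
  "real ^ 'nx ^ 'nx \<Rightarrow> real ^ 'nu ^ 'nx \<Rightarrow> real ^ 'nx ^ 'ny \<Rightarrow>
   real ^ 'nc ^ 'nc \<Rightarrow> real ^ 'ny ^ 'nc \<Rightarrow> real ^ 'nc ^ 'nu \<Rightarrow> real ^ 'ny ^ 'nu \<Rightarrow>
   real ^ ('nx + 'nc) ^ ('nx + 'nc)" where
  "flow_matrix A B C Ac Bc Cc Dc =
    block_matrix (A + B ** Dc ** C) (B ** Cc) (Bc ** C) Ac"

definition reset_matrix :: "real ^ ('nx::finite + 'nc::finite) ^ ('nx + 'nc)" where
  "reset_matrix = block_matrix (mat 1) 0 0 0"

text \<open>The controller starts from \<open>xc 0 = 0\<close>; at the positive multiples of \<open>T\<close> its state vanishes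
  by the reset rule. The plant starts from an arbitrary state.\<close>

definition closed_loop_signals ::
  "real ^ 'nx ^ 'nx \<Rightarrow> real ^ 'nu ^ 'nx \<Rightarrow> real ^ 'nx ^ 'ny \<Rightarrow>
   real ^ 'nc ^ 'nc \<Rightarrow> real ^ 'ny ^ 'nc \<Rightarrow> real ^ 'nc ^ 'nu \<Rightarrow> real ^ 'ny ^ 'nu \<Rightarrow> nat \<Rightarrow>
   (nat \<Rightarrow> real ^ 'nx) \<Rightarrow> (nat \<Rightarrow> real ^ 'nc) \<Rightarrow> (nat \<Rightarrow> real ^ 'nu) \<Rightarrow> (nat \<Rightarrow> real ^ 'ny) \<Rightarrow> bool" where
  "closed_loop_signals A B C Ac Bc Cc Dc T x xc u y \<longleftrightarrow>
     (\<forall>k. x (k + 1) = A *v x k + B *v u k) \<and>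
     (\<forall>k. y k = C *v x k) \<and>
     xc 0 = 0 \<and>
     (\<forall>k. xc (k + 1) = (if (k + 1) mod T \<noteq> 0 then Ac *v xc k + Bc *v y k else 0)) \<and>
     (\<forall>k. u k = Cc *v xc k + Dc *v y k)"

definition closed_loop_trajectories ::
  "real ^ 'nx ^ 'nx \<Rightarrow> real ^ 'nu ^ 'nx \<Rightarrow> real ^ 'nx ^ 'ny \<Rightarrow>
   real ^ 'nc ^ 'nc \<Rightarrow> real ^ 'ny ^ 'nc \<Rightarrow> real ^ 'nc ^ 'nu \<Rightarrow> real ^ 'ny ^ 'nu \<Rightarrow> nat \<Rightarrow>
   (nat \<Rightarrow> real ^ ('nx + 'nc)) set" where
  "closed_loop_trajectories A B C Ac Bc Cc Dc T =
     {z. \<exists>x xc u y. closed_loop_signals A B C Ac Bc Cc Dc T x xc u y \<and>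
           z = (\<lambda>k. stack (x k) (xc k))}"

text \<open>A system is represented by the set of its state trajectories from time 0. Global asymptotic
  stability of the origin is Lyapunov stability together with global attractivity.\<close>

definition globally_asymptotically_stable :: "(nat \<Rightarrow> 'a::real_normed_vector) set \<Rightarrow> bool" where
  "globally_asymptotically_stable S \<longleftrightarrow>
     (\<forall>e>0. \<exists>d>0. \<forall>z\<in>S. norm (z 0) < d \<longrightarrow> (\<forall>k. norm (z k) < e)) \<and>
     (\<forall>z\<in>S. z \<longlonglongrightarrow> 0)"

text \<open>Stability of the closed loop is not vacuous: every initial plant state has a trajectory.\<close>

lemma closed_loop_trajectory_exists:
  "\<exists>z\<in>closed_loop_trajectories A B C Ac Bc Cc Dc T. z 0 = stack x0 0"
proof -
  define s where "s = rec_nat (x0, 0) (\<lambda>k (p, q).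
    (A *v p + B *v (Cc *v q + Dc *v (C *v p)),
     if (k + 1) mod T \<noteq> 0 then Ac *v q + Bc *v (C *v p) else 0))"
  define x xc where "x = (\<lambda>k. fst (s k))" and "xc = (\<lambda>k. snd (s k))"
  have "closed_loop_signals A B C Ac Bc Cc Dc T x xc
      (\<lambda>k. Cc *v xc k + Dc *v (C *v x k)) (\<lambda>k. C *v x k)"
    by (simp add: closed_loop_signals_def x_def xc_def s_def case_prod_unfold)
  moreover have "x 0 = x0" "xc 0 = 0"
    by (simp_all add: x_def xc_def s_def)
  ultimately show ?thesis
    unfolding closed_loop_trajectories_def
    by (intro bexI[of _ "\<lambda>k. stack (x k) (xc k)"]) auto
qed

end

theory Submission imports Defs begin

text \<open>Let \<open>V z = z \<bullet> (P *v z)\<close>, \<open>r = 1 + \<mu>\<close> and \<open>q = \<delta> * r ^ (T - 1) < 1\<close>. A flow step multiplies \<open>V\<close> by at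
  most \<open>r\<close> and a step with a reset by at most \<open>\<delta>\<close>, so \<open>V (z k) \<le> q ^ (k div T) * r ^ (k mod T) * V (z 0)\<close>.
  Since \<open>V\<close> is equivalent to the squared norm, stability and attractivity follow.\<close>

text \<open>Comparing \<open>V\<close> with the squared norm on both sides transfers the decay of
  \<open>V\<close> to the norm. The bound \<open>c k \<le> 1\<close> gives a radius valid at all
  times, hence Lyapunov stability; the limit of \<open>c\<close> gives attractivity.\<close>

lemma globally_asymptotically_stableI:
  fixes S :: "(nat \<Rightarrow> 'a::real_normed_vector) set" and V :: "'a \<Rightarrow> real" and c :: "nat \<Rightarrow> real"
  assumes "0 < m" "0 < M"
    and lower: "\<And>v. m * (norm v)\<^sup>2 \<le> V v" and upper: "\<And>v. V v \<le> M * (norm v)\<^sup>2"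
    and decay: "\<And>z k. z \<in> S \<Longrightarrow> V (z k) \<le> c k * V (z 0)"
    and c_le: "\<And>k. c k \<le> 1" and c_lim: "c \<longlonglongrightarrow> 0"
  shows "globally_asymptotically_stable S"
  unfolding globally_asymptotically_stable_def
proof (intro conjI allI impI ballI)
  have V_nonneg: "0 \<le> V v" for v
    by (rule order_trans[OF _ lower]) (use \<open>0 < m\<close> in simp)
  fix e :: real assume "0 < e"
  \<comment> \<open>Chosen so that \<open>M * d\<^sup>2 = m * e\<^sup>2\<close>.\<close>
  define d where "d = sqrt (m / M) * e"
  have "norm (z k) < e" if "z \<in> S" "norm (z 0) < d" for z k
  proof -
    have "m * (norm (z k))\<^sup>2 \<le> c k * V (z 0)"
      using lower decay[OF \<open>z \<in> S\<close>] order_trans by blast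
    also have "\<dots> \<le> V (z 0)"
      using mult_right_mono[OF c_le V_nonneg] by simp
    also have "\<dots> \<le> M * (norm (z 0))\<^sup>2"
      by (rule upper)
    also have "\<dots> < M * d\<^sup>2"
      using \<open>0 < M\<close> that by (intro mult_strict_left_mono power_strict_mono) auto
    also have "\<dots> = m * e\<^sup>2"
      using \<open>0 < m\<close> \<open>0 < M\<close> by (simp add: d_def power_mult_distrib)
    finally have "(norm (z k))\<^sup>2 < e\<^sup>2"
      using \<open>0 < m\<close> by simp
    then show ?thesis
      using \<open>0 < e\<close> by (simp add: power_less_imp_less_base)
  qed
  moreover have "0 < d"
    using \<open>0 < m\<close> \<open>0 < M\<close> \<open>0 < e\<close> by (simp add: d_def)
  ultimately show "\<exists>d>0. \<forall>z\<in>S. norm (z 0) < d \<longrightarrow> (\<forall>k. norm (z k) < e)"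
    by blast
next
  fix z assume "z \<in> S"
  have bound: "(norm (z k))\<^sup>2 \<le> c k * V (z 0) / m" for k
    using order_trans[OF lower decay[OF \<open>z \<in> S\<close>]] \<open>0 < m\<close>
    by (simp add: pos_le_divide_eq mult.commute)
  have "(\<lambda>k. c k * V (z 0) / m) \<longlonglongrightarrow> 0"
    by (intro tendsto_divide_zero tendsto_mult_left_zero c_lim)
  then have "(\<lambda>k. (norm (z k))\<^sup>2) \<longlonglongrightarrow> 0"
    by (rule tendsto_sandwich[rotated 2, OF tendsto_const]) (use bound in auto)
  then have "(\<lambda>k. sqrt ((norm (z k))\<^sup>2)) \<longlonglongrightarrow> sqrt 0"
    by (rule tendsto_real_sqrt)
  then show "z \<longlonglongrightarrow> 0"
    by (simp add: tendsto_norm_zero_iff)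
qed

text \<open>Each completed period contributes \<open>T - 1\<close> flow factors and one jump factor;
  the current period has contributed only flow factors so far.\<close>

lemma periodic_jump_decay:
  fixes W :: "nat \<Rightarrow> real"
  assumes "1 \<le> T" "0 \<le> r" "0 \<le> d"
    and flow: "\<And>k. (k + 1) mod T \<noteq> 0 \<Longrightarrow> W (k + 1) \<le> r * W k"
    and jump: "\<And>k. (k + 1) mod T = 0 \<Longrightarrow> W (k + 1) \<le> d * W k"
  shows "W k \<le> (d * r ^ (T - 1)) ^ (k div T) * r ^ (k mod T) * W 0"
proof (induction k)
  case 0
  then show ?case by simp
next
  case (Suc k)
  show ?case
  proof (cases "Suc k mod T = 0")
    \<comment> \<open>The jump closes a period: its factor \<open>d\<close> joins the
      \<open>T - 1\<close> accumulated factors \<open>r\<close>, which raises the power of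
      \<open>d * r ^ (T - 1)\<close> by one and leaves \<open>r ^ 0\<close>.\<close>
    case True
    then have "k mod T = T - 1" and "Suc k div T = Suc (k div T)"
      using \<open>1 \<le> T\<close> by (auto simp: mod_Suc div_Suc split: if_splits)
    then show ?thesis
      using jump[of k] True mult_left_mono[OF Suc.IH \<open>0 \<le> d\<close>] by (simp add: mult_ac)
  next
    case False
    then have "Suc k mod T = Suc (k mod T)" and "Suc k div T = k div T"
      by (auto simp: mod_Suc div_Suc split: if_splits)
    then show ?thesis
      using flow[of k] False mult_left_mono[OF Suc.IH \<open>0 \<le> r\<close>] by (simp add: mult_ac)
  qed
qed

lemma inner_stack: "stack v w \<bullet> stack v' w' = v \<bullet> v' + w \<bullet> w'"
  \<comment> \<open>Writing the index set as a disjoint sum lets \<open>sum.Plus\<close> split the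
    inner product.\<close>
  unfolding inner_vec_def UNIV_Plus_UNIV[symmetric]
  by (subst sum.Plus) (simp_all add: stack_def)

lemma block_matrix_mult_stack:
  "block_matrix M11 M12 M21 M22 *v stack v w = stack (M11 *v v + M12 *v w) (M21 *v v + M22 *v w)"
  unfolding vec_eq_iff
  \<comment> \<open>The restricted instance of \<open>stack_def\<close> unfolds only the resulting
    vector, whose first part is a sum; the rows and \<open>stack v w\<close> stay folded for
    \<open>inner_stack\<close>.\<close>
  by (simp add: matrix_vector_mul_component block_matrix_def inner_stack stack_def[of "_ + _"]
      split: sum.split)

lemma transpose_reset_matrix: "transpose reset_matrix = reset_matrix"
  by (auto simp: vec_eq_iff transpose_def reset_matrix_def block_matrix_def stack_def mat_def
      split: sum.split)

lemma loewner_leD: "M \<preceq>\<^sub>L N \<Longrightarrow> v \<bullet> (M *v v) \<le> v \<bullet> (N *v v)"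
  by (auto simp: loewner_le_def pos_semidefinite_def matrix_vector_mult_diff_rdistrib inner_diff_right)

text \<open>The inequality is weak because both sides vanish at \<open>v = 0\<close>.\<close>

lemma loewner_lessD: "M \<prec>\<^sub>L N \<Longrightarrow> v \<bullet> (M *v v) \<le> v \<bullet> (N *v v)"
  by (cases "v = 0") (auto simp: loewner_less_def pos_definite_def matrix_vector_mult_diff_rdistrib
      inner_diff_right order_less_imp_le)

text \<open>Moving \<open>transpose M\<close> across the inner product turns the matrix inequalities
  into bounds on \<open>V\<close> after one step.\<close>

lemma quadratic_form_congruence:
  fixes M :: "real ^ 'n ^ 'n" and P :: "real ^ 'n ^ 'n"
  shows "v \<bullet> ((transpose M ** P ** M) *v v) = (M *v v) \<bullet> (P *v (M *v v))"
  by (metis dot_lmul_matrix inner_commute matrix_vector_mul_assoc transpose_matrix_vector)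

text \<open>Cauchy-Schwarz together with the boundedness of the linear map \<open>P\<close>.\<close>

lemma quadratic_form_upper_bound:
  fixes P :: "real ^ 'n ^ 'n"
  obtains M where "0 < M" "\<And>v. v \<bullet> (P *v v) \<le> M * (norm v)\<^sup>2"
proof -
  obtain K where K: "0 < K" "\<And>v. norm (P *v v) \<le> norm v * K"
    using bounded_linear.pos_bounded[OF matrix_vector_mul_bounded_linear] by blast
  have "v \<bullet> (P *v v) \<le> K * (norm v)\<^sup>2" for v
    using order_trans[OF norm_cauchy_schwarz mult_left_mono[OF K(2) norm_ge_zero], of v v]
    by (simp add: power2_eq_square mult_ac)
  with K(1) that show ?thesis by blast
qed

text \<open>Eliminating \<open>u\<close> and \<open>y\<close> leaves a block product on the stacked
  state; the reset matrix keeps the plant part and zeroes the controller part, as the reset rule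
  demands.\<close>

lemma closed_loop_step:
  fixes A :: "real ^ 'nx ^ 'nx" and B :: "real ^ 'nu ^ 'nx" and C :: "real ^ 'nx ^ 'ny"
    and Ac :: "real ^ 'nc ^ 'nc" and Bc :: "real ^ 'ny ^ 'nc"
    and Cc :: "real ^ 'nc ^ 'nu" and Dc :: "real ^ 'ny ^ 'nu"
  defines "F \<equiv> flow_matrix A B C Ac Bc Cc Dc"
  assumes "z \<in> closed_loop_trajectories A B C Ac Bc Cc Dc T"
  shows "z (k + 1) = (if (k + 1) mod T \<noteq> 0 then F *v z k else reset_matrix *v (F *v z k))"
proof -
  from assms(2) obtain x xc u y
    where "closed_loop_signals A B C Ac Bc Cc Dc T x xc u y" and z: "z = (\<lambda>k. stack (x k) (xc k))"
    unfolding closed_loop_trajectories_def by blast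
  then show ?thesis
    by (simp add: closed_loop_signals_def F_def flow_matrix_def reset_matrix_def
        block_matrix_mult_stack matrix_vector_mul_assoc[symmetric] matrix_vector_mult_add_rdistrib
        matrix_vector_right_distrib algebra_simps)
qed

theorem theorem1:
  fixes A :: "real ^ 'nx ^ 'nx" and B :: "real ^ 'nu ^ 'nx" and C :: "real ^ 'nx ^ 'ny"
    and Ac :: "real ^ 'nc ^ 'nc" and Bc :: "real ^ 'ny ^ 'nc"
    and Cc :: "real ^ 'nc ^ 'nu" and Dc :: "real ^ 'ny ^ 'nu"
    and T :: nat
    and F H :: "real ^ ('nx + 'nc) ^ ('nx + 'nc)"
  assumes "T \<ge> 1"
    and "F = flow_matrix A B C Ac Bc Cc Dc"
    and "H = reset_matrix"
    and "\<exists>(P :: real ^ ('nx + 'nc) ^ ('nx + 'nc)) (\<epsilon>::real) (\<mu>::real) (\<delta>::real) (\<epsilon>'::real).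
           transpose P = P \<and>
           \<epsilon> \<in> {0<..<1} \<and> \<mu> \<in> {-1..<0} \<and> \<delta> \<in> {1..} \<and> \<epsilon>' \<in> {0<..} \<and>
           \<epsilon>' *\<^sub>R mat 1 \<prec>\<^sub>L P \<and>
           transpose F ** P ** F \<preceq>\<^sub>L (1 + \<mu>) *\<^sub>R P \<and>
           transpose F ** H ** P ** H ** F \<preceq>\<^sub>L \<delta> *\<^sub>R P \<and>
           \<delta> * (1 + \<mu>) ^ (T - 1) < \<epsilon>"
  shows "globally_asymptotically_stable (closed_loop_trajectories A B C Ac Bc Cc Dc T)"
proof -
  \<comment> \<open>The witness for \<open>\<epsilon>'\<close> is called \<open>m\<close>, as it
    becomes the lower constant for \<open>V\<close>.\<close>
  obtain P :: "real ^ ('nx + 'nc) ^ ('nx + 'nc)" and \<epsilon> \<mu> \<delta> m :: real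
    where par: "\<epsilon> < 1" "-1 \<le> \<mu>" "\<mu> < 0" "1 \<le> \<delta>" "0 < m"
      and P: "m *\<^sub>R mat 1 \<prec>\<^sub>L P" "transpose F ** P ** F \<preceq>\<^sub>L (1 + \<mu>) *\<^sub>R P"
        "transpose F ** H ** P ** H ** F \<preceq>\<^sub>L \<delta> *\<^sub>R P"
      and q_less: "\<delta> * (1 + \<mu>) ^ (T - 1) < \<epsilon>"
    using assms(4) by auto
  define V where "V v = v \<bullet> (P *v v)" for v
  define q where "q = \<delta> * (1 + \<mu>) ^ (T - 1)"
  \<comment> \<open>For \<open>\<mu> = -1\<close> the second base is 0, and \<open>0 ^ 0 = 1\<close>
    keeps \<open>c k = q ^ (k div T)\<close> at multiples of \<open>T\<close>.\<close>
  define c where "c k = q ^ (k div T) * (1 + \<mu>) ^ (k mod T)" for k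
  have q: "0 \<le> q" "q < 1"
    using par q_less by (auto simp: q_def)
  have flow: "V (F *v v) \<le> (1 + \<mu>) * V v" for v
    using loewner_leD[OF P(2), of v]
    by (simp add: V_def quadratic_form_congruence scaleR_matrix_vector_assoc[symmetric])
  \<comment> \<open>Symmetry of \<open>H\<close> exhibits the reset condition as a congruence by
    \<open>H ** F\<close>.\<close>
  have "transpose F ** H ** P ** H ** F = transpose (H ** F) ** P ** (H ** F)"
    by (simp add: matrix_transpose_mul matrix_mul_assoc assms(3) transpose_reset_matrix)
  then have jump: "V (H *v (F *v v)) \<le> \<delta> * V v" for v
    using loewner_leD[OF P(3), of v]
    by (simp add: V_def quadratic_form_congruence matrix_vector_mul_assoc
        scaleR_matrix_vector_assoc[symmetric])
  have lower: "m * (norm v)\<^sup>2 \<le> V v" for v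
    using loewner_lessD[OF P(1), of v]
    by (simp add: V_def scaleR_matrix_vector_assoc[symmetric] power2_norm_eq_inner)
  obtain M where "0 < M" and upper: "\<And>v. V v \<le> M * (norm v)\<^sup>2"
    unfolding V_def using quadratic_form_upper_bound by blast
  have decay: "V (z k) \<le> c k * V (z 0)"
    if "z \<in> closed_loop_trajectories A B C Ac Bc Cc Dc T" for z k
    unfolding c_def q_def
    by (rule periodic_jump_decay[where W = "\<lambda>k. V (z k)"])
      (use \<open>T \<ge> 1\<close> par flow jump closed_loop_step[OF that] assms(2,3) in auto)
  \<comment> \<open>Within a period the flow factor is at most 1; the powers of \<open>q\<close>
    alone force convergence, since \<open>k div T\<close> grows without bound.\<close>
  have c_le: "c k \<le> q ^ (k div T)" for k
    using q par by (auto simp: c_def intro!: mult_left_le power_le_one)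
  have "filterlim (\<lambda>k. k div T) at_top sequentially"
    using \<open>T \<ge> 1\<close> by (intro filterlim_at_top_div_const_nat) simp
  then have "(\<lambda>k. q ^ (k div T)) \<longlonglongrightarrow> 0"
    using filterlim_compose[OF LIMSEQ_power_zero[of q]] q by simp
  then have "c \<longlonglongrightarrow> 0"
    by (rule tendsto_sandwich[rotated 2, OF tendsto_const])
      (use q par c_le in \<open>auto simp: c_def\<close>)
  moreover have "c k \<le> 1" for k
    using order_trans[OF c_le power_le_one] q by simp
  ultimately show ?thesis
    using globally_asymptotically_stableI[OF \<open>0 < m\<close> \<open>0 < M\<close> lower upper decay] by blast
qed

end
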